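(* Let $N$ and $H$ be groups, $\phi:H\to Sym(N)_1$ a group homomorphism, and $L=N\rtimes_\phi H$ the corresponding loop. Then the right nucleus $N_\rho(L)$ is a group (under the operation of $L$).
   Context: $Sym(N)_1$ is the stabilizer of the identity $1\in N$ in the group of all permutations of $N$; write $\phi_h=\phi(h)$. $N\rtimes_\phi H$ is the loop on $N\times H$ with operation $(n_1,h_1)(n_2,h_2)=(n_1\phi_{h_1}(n_2),h_1h_2)$. The right nucleus is $N_\rho(L)=\{a\in L\mid x(ya)=(xy)a\ \forall x,y\in L\}$. *)

theory Defs
  imports "HOL-Algebra.Bij"
begin

(* Permutations of the carrier are encoded, as in BijGroup, by bijections of the carrier
   that are extensional (undefined outside it); the product is composition of maps. *)
definition Sym_stab_one :: "('a, 'c) monoid_scheme \<Rightarrow> ('a \<Rightarrow> 'a) monoid" where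
  "Sym_stab_one N =
     (BijGroup (carrier N))\<lparr>carrier := {f \<in> carrier (BijGroup (carrier N)). f \<one>\<^bsub>N\<^esub> = \<one>\<^bsub>N\<^esub>}\<rparr>"

(* The record type monoid carries only a carrier, a multiplication and a unit;
   no associativity is implied. *)
definition semidirect_loop ::
  "('a, 'c) monoid_scheme \<Rightarrow> ('b, 'd) monoid_scheme \<Rightarrow> ('b \<Rightarrow> 'a \<Rightarrow> 'a) \<Rightarrow> ('a \<times> 'b) monoid" where
  "semidirect_loop N H \<phi> =
     \<lparr>carrier = carrier N \<times> carrier H,
      mult = (\<lambda>(n1, h1) (n2, h2). (n1 \<otimes>\<^bsub>N\<^esub> \<phi> h1 n2, h1 \<otimes>\<^bsub>H\<^esub> h2)),
      one = (\<one>\<^bsub>N\<^esub>, \<one>\<^bsub>H\<^esub>)\<rparr>"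

definition is_loop :: "('a, 'c) monoid_scheme \<Rightarrow> bool" where
  "is_loop L \<longleftrightarrow>
     (\<forall>x \<in> carrier L. \<forall>y \<in> carrier L. x \<otimes>\<^bsub>L\<^esub> y \<in> carrier L) \<and>
     \<one>\<^bsub>L\<^esub> \<in> carrier L \<and>
     (\<forall>x \<in> carrier L. \<one>\<^bsub>L\<^esub> \<otimes>\<^bsub>L\<^esub> x = x \<and> x \<otimes>\<^bsub>L\<^esub> \<one>\<^bsub>L\<^esub> = x) \<and>
     (\<forall>a \<in> carrier L. \<forall>b \<in> carrier L. \<exists>!x. x \<in> carrier L \<and> a \<otimes>\<^bsub>L\<^esub> x = b) \<and>
     (\<forall>a \<in> carrier L. \<forall>b \<in> carrier L. \<exists>!y. y \<in> carrier L \<and> y \<otimes>\<^bsub>L\<^esub> a = b)"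

definition right_nucleus :: "('a, 'c) monoid_scheme \<Rightarrow> 'a set" where
  "right_nucleus L =
     {a \<in> carrier L. \<forall>x \<in> carrier L. \<forall>y \<in> carrier L.
        x \<otimes>\<^bsub>L\<^esub> (y \<otimes>\<^bsub>L\<^esub> a) = (x \<otimes>\<^bsub>L\<^esub> y) \<otimes>\<^bsub>L\<^esub> a}"

lemma is_loop_semidirect_loop:
  assumes N: "group N" and H: "group H" and hom: "\<phi> \<in> hom H (Sym_stab_one N)"
  shows "is_loop (semidirect_loop N H \<phi>)"
proof -
  interpret N: group N by (fact N)
  interpret H: group H by (fact H)
  have bij: "bij_betw (\<phi> h) (carrier N) (carrier N)" and ext: "\<phi> h \<in> extensional (carrier N)"
    and one: "\<phi> h \<one>\<^bsub>N\<^esub> = \<one>\<^bsub>N\<^esub>" if "h \<in> carrier H" for h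
    using hom that by (auto simp: hom_def Sym_stab_one_def BijGroup_def Bij_def)
  have cl [simp]: "\<phi> h n \<in> carrier N" if "h \<in> carrier H" "n \<in> carrier N" for h n
    using bij[OF that(1)] that(2) by (auto simp: bij_betw_def)
  have "\<phi> (\<one>\<^bsub>H\<^esub> \<otimes>\<^bsub>H\<^esub> \<one>\<^bsub>H\<^esub>) = \<phi> \<one>\<^bsub>H\<^esub> \<otimes>\<^bsub>Sym_stab_one N\<^esub> \<phi> \<one>\<^bsub>H\<^esub>"
    using hom H.one_closed unfolding hom_def by blast
  then have "compose (carrier N) (\<phi> \<one>\<^bsub>H\<^esub>) (\<phi> \<one>\<^bsub>H\<^esub>) = \<phi> \<one>\<^bsub>H\<^esub>"
    using bij[OF H.one_closed] ext[OF H.one_closed]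
    by (simp add: Sym_stab_one_def BijGroup_def Bij_def)
  then have idem: "\<phi> \<one>\<^bsub>H\<^esub> (\<phi> \<one>\<^bsub>H\<^esub> n) = \<phi> \<one>\<^bsub>H\<^esub> n" if "n \<in> carrier N" for n
    using that by (metis compose_eq)
  have id: "\<phi> \<one>\<^bsub>H\<^esub> n = n" if "n \<in> carrier N" for n
    by (rule inj_onD[OF bij_betw_imp_inj_on[OF bij[OF H.one_closed]] idem[OF that]])
      (simp_all add: that)
  have left: "\<exists>!x. x \<in> carrier N \<times> carrier H \<and>
      (case x of (n, h) \<Rightarrow> (a \<otimes>\<^bsub>N\<^esub> \<phi> g n, g \<otimes>\<^bsub>H\<^esub> h)) = (b, k)"
    if *: "a \<in> carrier N" "g \<in> carrier H" "b \<in> carrier N" "k \<in> carrier H" for a g b k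
  proof -
    obtain n where n: "n \<in> carrier N" "\<phi> g n = inv\<^bsub>N\<^esub> a \<otimes>\<^bsub>N\<^esub> b"
      using bij[OF *(2)] * by (metis N.inv_closed N.m_closed bij_betw_def imageE)
    show ?thesis
    proof (rule ex1I[of _ "(n, inv\<^bsub>H\<^esub> g \<otimes>\<^bsub>H\<^esub> k)"])
      show "(n, inv\<^bsub>H\<^esub> g \<otimes>\<^bsub>H\<^esub> k) \<in> carrier N \<times> carrier H \<and>
        (case (n, inv\<^bsub>H\<^esub> g \<otimes>\<^bsub>H\<^esub> k) of (n, h) \<Rightarrow> (a \<otimes>\<^bsub>N\<^esub> \<phi> g n, g \<otimes>\<^bsub>H\<^esub> h)) = (b, k)"
        using n * by (simp add: N.m_assoc[symmetric] H.m_assoc[symmetric])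
    next
      fix x assume x: "x \<in> carrier N \<times> carrier H \<and>
        (case x of (n, h) \<Rightarrow> (a \<otimes>\<^bsub>N\<^esub> \<phi> g n, g \<otimes>\<^bsub>H\<^esub> h)) = (b, k)"
      obtain m h where mh: "x = (m, h)" by (cases x)
      have m: "m \<in> carrier N" "h \<in> carrier H" "a \<otimes>\<^bsub>N\<^esub> \<phi> g m = b" "g \<otimes>\<^bsub>H\<^esub> h = k"
        using x mh by auto
      have "\<phi> g m = \<phi> g n" using m n * by (simp add: N.inv_solve_left)
      then have "m = n" using inj_onD[OF bij_betw_imp_inj_on[OF bij[OF *(2)]]] m n by blast
      moreover have "h = inv\<^bsub>H\<^esub> g \<otimes>\<^bsub>H\<^esub> k" using m * by (simp add: H.inv_solve_left)
      ultimately show "x = (n, inv\<^bsub>H\<^esub> g \<otimes>\<^bsub>H\<^esub> k)" using mh by simp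
    qed
  qed
  have right: "\<exists>!y. y \<in> carrier N \<times> carrier H \<and>
      (case y of (n, h) \<Rightarrow> \<lambda>(n2, h2). (n \<otimes>\<^bsub>N\<^esub> \<phi> h n2, h \<otimes>\<^bsub>H\<^esub> h2)) (a, g) = (b, k)"
    if *: "a \<in> carrier N" "g \<in> carrier H" "b \<in> carrier N" "k \<in> carrier H" for a g b k
  proof -
    let ?h = "k \<otimes>\<^bsub>H\<^esub> inv\<^bsub>H\<^esub> g"
    show ?thesis
    proof (rule ex1I[of _ "(b \<otimes>\<^bsub>N\<^esub> inv\<^bsub>N\<^esub> (\<phi> ?h a), ?h)"])
      show "(b \<otimes>\<^bsub>N\<^esub> inv\<^bsub>N\<^esub> (\<phi> ?h a), ?h) \<in> carrier N \<times> carrier H \<and>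
        (case (b \<otimes>\<^bsub>N\<^esub> inv\<^bsub>N\<^esub> (\<phi> ?h a), ?h) of
          (n, h) \<Rightarrow> \<lambda>(n2, h2). (n \<otimes>\<^bsub>N\<^esub> \<phi> h n2, h \<otimes>\<^bsub>H\<^esub> h2)) (a, g) = (b, k)"
        using * by (simp add: N.m_assoc H.m_assoc)
    next
      fix y assume y: "y \<in> carrier N \<times> carrier H \<and>
        (case y of (n, h) \<Rightarrow> \<lambda>(n2, h2). (n \<otimes>\<^bsub>N\<^esub> \<phi> h n2, h \<otimes>\<^bsub>H\<^esub> h2)) (a, g) = (b, k)"
      obtain m h where mh: "y = (m, h)" by (cases y)
      have m: "m \<in> carrier N" "h \<in> carrier H" "m \<otimes>\<^bsub>N\<^esub> \<phi> h a = b" "h \<otimes>\<^bsub>H\<^esub> g = k"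
        using y mh by auto
      have h: "h = ?h" using m * by (simp add: H.inv_solve_right)
      have "m = b \<otimes>\<^bsub>N\<^esub> inv\<^bsub>N\<^esub> (\<phi> h a)" using m * by (simp add: N.inv_solve_right)
      then show "y = (b \<otimes>\<^bsub>N\<^esub> inv\<^bsub>N\<^esub> (\<phi> ?h a), ?h)" using mh h by metis
    qed
  qed
  show ?thesis
    unfolding is_loop_def using left right
    by (auto simp: semidirect_loop_def id one split_beta)
qed

end

theory Submission
  imports Defs
begin

text \<open>
  The result holds because \<open>L\<close> is a loop: the right nucleus of any loop is a group.
  Elements of the right nucleus associate with everything to their left, so the nucleus is
  closed under products, contains the unit and is itself associative. Only inverses need an
  idea. If \<open>b a = 1\<close> with \<open>a\<close> in the nucleus, then multiplying \<open>x (y b)\<close> and \<open>(x y) b\<close> by \<open>a\<close>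
  on the right gives \<open>x y\<close> in both cases, and right cancellation in the loop shows that
  \<open>b\<close> is in the nucleus as well.
\<close>

lemma right_nucleus_assoc:
  assumes "a \<in> right_nucleus L" "x \<in> carrier L" "y \<in> carrier L"
  shows "(x \<otimes>\<^bsub>L\<^esub> y) \<otimes>\<^bsub>L\<^esub> a = x \<otimes>\<^bsub>L\<^esub> (y \<otimes>\<^bsub>L\<^esub> a)"
  using assms by (simp add: right_nucleus_def)

lemma right_nucleus_subset: "right_nucleus L \<subseteq> carrier L"
  by (auto simp: right_nucleus_def)

lemma loop_closed: "is_loop L \<Longrightarrow> x \<in> carrier L \<Longrightarrow> y \<in> carrier L \<Longrightarrow> x \<otimes>\<^bsub>L\<^esub> y \<in> carrier L"
  by (simp add: is_loop_def)

lemma loop_unit: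
  assumes "is_loop L"
  shows "\<one>\<^bsub>L\<^esub> \<in> carrier L"
    and "x \<in> carrier L \<Longrightarrow> \<one>\<^bsub>L\<^esub> \<otimes>\<^bsub>L\<^esub> x = x"
    and "x \<in> carrier L \<Longrightarrow> x \<otimes>\<^bsub>L\<^esub> \<one>\<^bsub>L\<^esub> = x"
  using assms by (simp_all add: is_loop_def)

lemma loop_right_division:
  assumes "is_loop L" "a \<in> carrier L" "b \<in> carrier L"
  shows "\<exists>!y. y \<in> carrier L \<and> y \<otimes>\<^bsub>L\<^esub> a = b"
  using assms by (simp add: is_loop_def)

lemma loop_right_cancel:
  assumes "is_loop L" "a \<in> carrier L" "u \<in> carrier L" "v \<in> carrier L"
    and "u \<otimes>\<^bsub>L\<^esub> a = v \<otimes>\<^bsub>L\<^esub> a"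
  shows "u = v"
  using loop_right_division[OF assms(1,2) loop_closed[OF assms(1,4,2)]] assms(3-5) by blast

lemma right_nucleus_mult_closed:
  assumes closed: "\<And>x y. x \<in> carrier L \<Longrightarrow> y \<in> carrier L \<Longrightarrow> x \<otimes>\<^bsub>L\<^esub> y \<in> carrier L"
    and a: "a \<in> right_nucleus L" and b: "b \<in> right_nucleus L"
  shows "a \<otimes>\<^bsub>L\<^esub> b \<in> right_nucleus L"
proof -
  note aL = subsetD[OF right_nucleus_subset a] and bL = subsetD[OF right_nucleus_subset b]
  have "x \<otimes>\<^bsub>L\<^esub> (y \<otimes>\<^bsub>L\<^esub> (a \<otimes>\<^bsub>L\<^esub> b)) = (x \<otimes>\<^bsub>L\<^esub> y) \<otimes>\<^bsub>L\<^esub> (a \<otimes>\<^bsub>L\<^esub> b)"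
    if x: "x \<in> carrier L" and y: "y \<in> carrier L" for x y
  proof -
    have "x \<otimes>\<^bsub>L\<^esub> (y \<otimes>\<^bsub>L\<^esub> (a \<otimes>\<^bsub>L\<^esub> b)) = x \<otimes>\<^bsub>L\<^esub> ((y \<otimes>\<^bsub>L\<^esub> a) \<otimes>\<^bsub>L\<^esub> b)"
      by (simp add: right_nucleus_assoc[OF b] y aL)
    also have "\<dots> = (x \<otimes>\<^bsub>L\<^esub> (y \<otimes>\<^bsub>L\<^esub> a)) \<otimes>\<^bsub>L\<^esub> b"
      by (simp add: right_nucleus_assoc[OF b] x y aL closed)
    also have "\<dots> = ((x \<otimes>\<^bsub>L\<^esub> y) \<otimes>\<^bsub>L\<^esub> a) \<otimes>\<^bsub>L\<^esub> b"
      by (simp add: right_nucleus_assoc[OF a] x y)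
    also have "\<dots> = (x \<otimes>\<^bsub>L\<^esub> y) \<otimes>\<^bsub>L\<^esub> (a \<otimes>\<^bsub>L\<^esub> b)"
      by (simp add: right_nucleus_assoc[OF b] x y aL closed)
    finally show ?thesis .
  qed
  then show ?thesis using closed[OF aL bL] by (simp add: right_nucleus_def)
qed

text \<open>
  By right cancellation the two bracketings of \<open>x\<close>, \<open>y\<close>, \<open>b\<close> may be compared after multiplying by
  \<open>a\<close>, where \<open>a\<close> being in the nucleus lets \<open>b a = 1\<close> be collected on the right.
\<close>

lemma right_nucleus_left_inverse:
  assumes L: "is_loop L" and a: "a \<in> right_nucleus L"
    and b: "b \<in> carrier L" and ba: "b \<otimes>\<^bsub>L\<^esub> a = \<one>\<^bsub>L\<^esub>"
  shows "b \<in> right_nucleus L"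
proof -
  note aL = subsetD[OF right_nucleus_subset a]
  note closed = loop_closed[OF L] and unit = loop_unit[OF L]
  have "x \<otimes>\<^bsub>L\<^esub> (y \<otimes>\<^bsub>L\<^esub> b) = (x \<otimes>\<^bsub>L\<^esub> y) \<otimes>\<^bsub>L\<^esub> b"
    if x: "x \<in> carrier L" and y: "y \<in> carrier L" for x y
  proof (rule loop_right_cancel[OF L aL])
    show "(x \<otimes>\<^bsub>L\<^esub> (y \<otimes>\<^bsub>L\<^esub> b)) \<otimes>\<^bsub>L\<^esub> a = ((x \<otimes>\<^bsub>L\<^esub> y) \<otimes>\<^bsub>L\<^esub> b) \<otimes>\<^bsub>L\<^esub> a"
      by (simp add: right_nucleus_assoc[OF a] x y b closed ba unit)
  qed (simp_all add: x y b closed)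
  then show ?thesis using b by (simp add: right_nucleus_def)
qed

lemma group_right_nucleus:
  assumes L: "is_loop L"
  shows "group (L\<lparr>carrier := right_nucleus L\<rparr>)"
proof (rule groupI)
  note closed = loop_closed[OF L] and unit = loop_unit[OF L]
  let ?R = "L\<lparr>carrier := right_nucleus L\<rparr>"
  show "\<one>\<^bsub>?R\<^esub> \<in> carrier ?R"
    by (simp add: unit closed right_nucleus_def)
  fix a assume "a \<in> carrier ?R"
  then have a: "a \<in> right_nucleus L" by simp
  note aL = subsetD[OF right_nucleus_subset a]
  show "\<one>\<^bsub>?R\<^esub> \<otimes>\<^bsub>?R\<^esub> a = a" by (simp add: unit aL)
  have "\<exists>b. b \<in> carrier L \<and> b \<otimes>\<^bsub>L\<^esub> a = \<one>\<^bsub>L\<^esub>"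
    using loop_right_division[OF L aL unit(1)] by (rule ex1_implies_ex)
  then show "\<exists>b\<in>carrier ?R. b \<otimes>\<^bsub>?R\<^esub> a = \<one>\<^bsub>?R\<^esub>"
    by (auto intro: right_nucleus_left_inverse[OF L a])
  fix b assume "b \<in> carrier ?R"
  then have b: "b \<in> right_nucleus L" by simp
  show "a \<otimes>\<^bsub>?R\<^esub> b \<in> carrier ?R"
    using right_nucleus_mult_closed[OF closed a b] by simp
  fix c assume "c \<in> carrier ?R"
  then have c: "c \<in> right_nucleus L" by simp
  show "a \<otimes>\<^bsub>?R\<^esub> b \<otimes>\<^bsub>?R\<^esub> c = a \<otimes>\<^bsub>?R\<^esub> (b \<otimes>\<^bsub>?R\<^esub> c)"
    using right_nucleus_assoc[OF c aL subsetD[OF right_nucleus_subset b]] by simp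
qed

theorem proposition3p10:
  fixes N :: "('a, 'c) monoid_scheme"
    and H :: "('b, 'd) monoid_scheme"
    and \<phi> :: "'b \<Rightarrow> 'a \<Rightarrow> 'a"
    and L :: "('a \<times> 'b) monoid"
  assumes "group N"
    and "group H"
    and "\<phi> \<in> hom H (Sym_stab_one N)"
    and "L = semidirect_loop N H \<phi>"
  shows "group (L\<lparr>carrier := right_nucleus L\<rparr>)"
  unfolding assms(4) by (rule group_right_nucleus[OF is_loop_semidirect_loop[OF assms(1-3)]])

end
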